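(* Let $F$ be a field, let $K=\partial\Delta^5$ be the boundary of one 5-simplex with ordered vertices, oriented as the boundary of $\Delta^5$, and let $\omega$ be a generic simplicial 3-cocycle on it which is the coboundary of a 2-cochain. Then the set of F-colorings of $K$ defined using the explicit triangle functionals $\mathsf f_s$ with a cochain $\gamma$ such that $\partial\gamma=\omega$ is the same as the set of V-colorings of $K$ defined using the explicit triangle vectors $\mathsf e_s$ built from the same $\omega$.
   Context: **Cochains.** A 2-cochain $\gamma$ assigns to triangles elements $\gamma_{ijk}\in F$, alternating under change of orientation; its coboundary is $(\partial\gamma)_{ijkl}=\gamma_{ijk}-\gamma_{ijl}+\gamma_{ikl}-\gamma_{jkl}$. Thus $\omega$ satisfies $\omega_{jklm}-\omega_{iklm}+\omega_{ijlm}-\omega_{ijkm}+\omega_{ijkl}=0$ on every 4-simplex. "Generic" means here that $\omega_{ijkl}\neq 0$ for all tetrahedra $ijkl$. The explicit functionals and vectors below depend on cochains only through $\omega$. **Colorings.** A coloring of $K$ assigns to each 4-simplex $u$ (pentachoron) a color in $F^3$; the color changes sign when the orientation of $u$ changes. Below, $x_u\in F^3$ is the color of $u$ with respect to the orientation given by the increasing order of its vertices. **Triangle vectors and V-colorings.** For each triangle $s$ (oriented by increasing order of vertices) the triangle vector $\mathsf e_s$ is the coloring whose component on $u$ is zero unless $u\supset s$, and for $u=12345$ is the row of the table below. For any $u=ijklm$ with $i<j<k<l<m$, substitute $1\mapsto i,\dots,5\mapsto m$. $$\begin{array}{c|ccc} s & & \mathsf e_s|_{12345} & \\ \hline 123 &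 0 & \omega_{1345} & \omega_{1235}-\omega_{1234}\\ 124 & 0 & 0 & -\omega_{1235}\\ 125 & 0 & -\omega_{1345} & \omega_{1234}\\ 134 & \omega_{2345} & -\omega_{1235} & \omega_{1235}\\ 135 & -\omega_{2345} & \omega_{1345}+\omega_{1235} & -\omega_{1234}\\ 145 & \omega_{2345} & -\omega_{1235} & 0\\ 234 & -\omega_{1345} & 0 & -\omega_{1235}\\ 235 & \omega_{1345} & -\omega_{1345} & \omega_{1234}\\ 245 & -\omega_{1345} & 0 & 0\\ 345 & \omega_{1345}-\omega_{2345} & \omega_{1235} & 0 \end{array}$$ V-colorings of $K$ are the elements of the linear span of the triangle vectors $\mathsf e_s$ over all triangles $s$ of $K$. **Triangle functionals and F-colorings.** For each triangle $s$ the triangle functional is the linear form on colorings $\mathsf f_s(x)=\sum_{u\supset s}\sigma_u\,\mathsf f_s|_u\cdot x_u$, where $\sigma_u=+1$ if the orientation of $u$ in $K$ coincides with the one given by the increasing order of its vertices, $\sigma_u=-1$ otherwise, $\cdot$ is the standard pairing of triples, and $\mathsf f_s|_u$ for $u=12345$ is the row of the table below. For $u=ijklm$, $i<j<k<l<m$, substitute $1\mapsto i,\dots,5\mapsto m$. $$\begin{array}{c|ccc} s & & \mathsf f_s|_{12345} & \\ \hline 123 & 0 & 0 & \frac{1}{\omega_{1234}\omega_{1235}}\\ 124 & \frac{1}{\omega_{1245}\omega_{1345}} & -\frac{\omega_{1345}-\omega_{2345}}{\omega_{1235}\omega_{1245}\omega_{1345}} & -\frac{\omega_{1245}+\omega_{1234}}{\omega_{1234}\omega_{1235}\omega_{1245}}\\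 125 & -\frac{1}{\omega_{1245}\omega_{1345}} & \frac{\omega_{1345}-\omega_{2345}}{\omega_{1235}\omega_{1245}\omega_{1345}} & \frac{1}{\omega_{1235}\omega_{1245}}\\ 134 & 0 & \frac{1}{\omega_{1235}\omega_{1345}} & \frac{1}{\omega_{1234}\omega_{1235}}\\ 135 & 0 & -\frac{1}{\omega_{1235}\omega_{1345}} & 0\\ 145 & \frac{1}{\omega_{1245}\omega_{1345}} & \frac{\omega_{1235}-\omega_{1234}}{\omega_{1235}\omega_{1245}\omega_{1345}} & -\frac{1}{\omega_{1235}\omega_{1245}}\\ 234 & -\frac{1}{\omega_{1345}\omega_{2345}} & -\frac{1}{\omega_{1235}\omega_{1345}} & -\frac{1}{\omega_{1234}\omega_{1235}}\\ 235 & \frac{1}{\omega_{1345}\omega_{2345}} & \frac{1}{\omega_{1235}\omega_{1345}} & 0\\ 245 & -\frac{\omega_{2345}+\omega_{1245}}{\omega_{1245}\omega_{1345}\omega_{2345}} & -\frac{\omega_{1235}-\omega_{1234}}{\omega_{1235}\omega_{1245}\omega_{1345}} & \frac{1}{\omega_{1235}\omega_{1245}}\\ 345 & \frac{1}{\omega_{1345}\omega_{2345}} & 0 & 0 \end{array}$$ F-colorings of $K$ are the colorings on which all $\mathsf f_s$ vanish. *)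

theory Defs
  imports "HOL-Analysis.Analysis" "HOL-Library.Function_Algebras"
begin

text \<open>A simplex is the set of its vertices. For \<open>V\<close> with six elements,
  \<open>simplices k V\<close> with \<open>k \<le> 4\<close> are the \<open>k\<close>-simplices of the boundary of the 5-simplex on \<open>V\<close>.\<close>

definition simplices :: "nat \<Rightarrow> 'v set \<Rightarrow> 'v set set" where
  "simplices k V = {s. s \<subseteq> V \<and> card s = k + 1}"

text \<open>Cochains are functions of ordered tuples of vertices; only tuples of distinct elements
  of \<open>V\<close> matter. Adjacent transpositions generate all changes of orientation.\<close>

definition cochain2 :: "'v set \<Rightarrow> ('v \<Rightarrow> 'v \<Rightarrow> 'v \<Rightarrow> 'a::field) \<Rightarrow> bool" where
  "cochain2 V \<gamma> \<longleftrightarrow> (\<forall>i\<in>V. \<forall>j\<in>V. \<forall>k\<in>V. distinct [i, j, k] \<longrightarrow>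
     \<gamma> j i k = - \<gamma> i j k \<and> \<gamma> i k j = - \<gamma> i j k)"

definition cochain3 :: "'v set \<Rightarrow> ('v \<Rightarrow> 'v \<Rightarrow> 'v \<Rightarrow> 'v \<Rightarrow> 'a::field) \<Rightarrow> bool" where
  "cochain3 V \<omega> \<longleftrightarrow> (\<forall>i\<in>V. \<forall>j\<in>V. \<forall>k\<in>V. \<forall>l\<in>V. distinct [i, j, k, l] \<longrightarrow>
     \<omega> j i k l = - \<omega> i j k l \<and> \<omega> i k j l = - \<omega> i j k l \<and> \<omega> i j l k = - \<omega> i j k l)"

definition coboundary2 :: "('v \<Rightarrow> 'v \<Rightarrow> 'v \<Rightarrow> 'a::field) \<Rightarrow> 'v \<Rightarrow> 'v \<Rightarrow> 'v \<Rightarrow> 'v \<Rightarrow> 'a" where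
  "coboundary2 \<gamma> i j k l = \<gamma> i j k - \<gamma> i j l + \<gamma> i k l - \<gamma> j k l"

definition is_coboundary_of ::
    "'v set \<Rightarrow> ('v \<Rightarrow> 'v \<Rightarrow> 'v \<Rightarrow> 'v \<Rightarrow> 'a::field) \<Rightarrow> ('v \<Rightarrow> 'v \<Rightarrow> 'v \<Rightarrow> 'a) \<Rightarrow> bool" where
  "is_coboundary_of V \<omega> \<gamma> \<longleftrightarrow> (\<forall>i\<in>V. \<forall>j\<in>V. \<forall>k\<in>V. \<forall>l\<in>V. distinct [i, j, k, l] \<longrightarrow>
     \<omega> i j k l = coboundary2 \<gamma> i j k l)"

definition cocycle3 :: "'v set \<Rightarrow> ('v \<Rightarrow> 'v \<Rightarrow> 'v \<Rightarrow> 'v \<Rightarrow> 'a::field) \<Rightarrow> bool" where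
  "cocycle3 V \<omega> \<longleftrightarrow> cochain3 V \<omega> \<and>
     (\<forall>i\<in>V. \<forall>j\<in>V. \<forall>k\<in>V. \<forall>l\<in>V. \<forall>m\<in>V. distinct [i, j, k, l, m] \<longrightarrow>
        \<omega> j k l m - \<omega> i k l m + \<omega> i j l m - \<omega> i j k m + \<omega> i j k l = 0)"

definition generic :: "'v set \<Rightarrow> ('v \<Rightarrow> 'v \<Rightarrow> 'v \<Rightarrow> 'v \<Rightarrow> 'a::field) \<Rightarrow> bool" where
  "generic V \<omega> \<longleftrightarrow> (\<forall>i\<in>V. \<forall>j\<in>V. \<forall>k\<in>V. \<forall>l\<in>V. distinct [i, j, k, l] \<longrightarrow> \<omega> i j k l \<noteq> 0)"

text \<open>A coloring is given by the colors \<open>x u\<close> of the 4-simplices \<open>u\<close> with respect to the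
  orientation of \<open>u\<close> by the increasing order of its vertices; the color for the opposite
  orientation is \<open>- x u\<close>. Off the 4-simplices a coloring is \<open>0\<close>, so that equality and linear
  combinations of colorings are those of functions.\<close>

definition colorings :: "'v set \<Rightarrow> ('v set \<Rightarrow> 'a::field ^ 3) set" where
  "colorings V = {x. \<forall>u. u \<notin> simplices 4 V \<longrightarrow> x u = 0}"

definition coloring_scale :: "'a::field \<Rightarrow> ('v set \<Rightarrow> 'a ^ 3) \<Rightarrow> 'v set \<Rightarrow> 'a ^ 3" where
  "coloring_scale c x = (\<lambda>u. c *s x u)"

interpretation coloring: vector_space "coloring_scale :: 'a::field \<Rightarrow> ('v set \<Rightarrow> 'a ^ 3) \<Rightarrow> _"
  by unfold_locales
    (simp_all add: coloring_scale_def fun_eq_iff vec.scale_right_distrib vec.scale_left_distrib)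

text \<open>The two tables, for a 4-simplex with vertices \<open>i < j < k < l < m\<close>.\<close>

definition vector_table ::
    "('v \<Rightarrow> 'v \<Rightarrow> 'v \<Rightarrow> 'v \<Rightarrow> 'a::field) \<Rightarrow> 'v \<Rightarrow> 'v \<Rightarrow> 'v \<Rightarrow> 'v \<Rightarrow> 'v \<Rightarrow> 'v set \<Rightarrow> 'a ^ 3" where
  "vector_table \<omega> i j k l m s = (
    if s = {i, j, k} then vector [0, \<omega> i k l m, \<omega> i j k m - \<omega> i j k l]
     else if s = {i, j, l} then vector [0, 0, - \<omega> i j k m]
     else if s = {i, j, m} then vector [0, - \<omega> i k l m, \<omega> i j k l]
     else if s = {i, k, l} then vector [\<omega> j k l m, - \<omega> i j k m, \<omega> i j k m]
     else if s = {i, k, m} then vector [- \<omega> j k l m, \<omega> i k l m + \<omega> i j k m, - \<omega> i j k l]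
     else if s = {i, l, m} then vector [\<omega> j k l m, - \<omega> i j k m, 0]
     else if s = {j, k, l} then vector [- \<omega> i k l m, 0, - \<omega> i j k m]
     else if s = {j, k, m} then vector [\<omega> i k l m, - \<omega> i k l m, \<omega> i j k l]
     else if s = {j, l, m} then vector [- \<omega> i k l m, 0, 0]
     else if s = {k, l, m} then vector [\<omega> i k l m - \<omega> j k l m, \<omega> i j k m, 0]
     else 0)"

definition functional_table ::
    "('v \<Rightarrow> 'v \<Rightarrow> 'v \<Rightarrow> 'v \<Rightarrow> 'a::field) \<Rightarrow> 'v \<Rightarrow> 'v \<Rightarrow> 'v \<Rightarrow> 'v \<Rightarrow> 'v \<Rightarrow> 'v set \<Rightarrow> 'a ^ 3" where
  "functional_table \<omega> i j k l m s = (
    if s = {i, j, k} then vector [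
        0,
        0,
        1 / (\<omega> i j k l * \<omega> i j k m)]
     else if s = {i, j, l} then vector [
        1 / (\<omega> i j l m * \<omega> i k l m),
        - ((\<omega> i k l m - \<omega> j k l m) / (\<omega> i j k m * \<omega> i j l m * \<omega> i k l m)),
        - ((\<omega> i j l m + \<omega> i j k l) / (\<omega> i j k l * \<omega> i j k m * \<omega> i j l m))]
     else if s = {i, j, m} then vector [
        - (1 / (\<omega> i j l m * \<omega> i k l m)),
        (\<omega> i k l m - \<omega> j k l m) / (\<omega> i j k m * \<omega> i j l m * \<omega> i k l m),
        1 / (\<omega> i j k m * \<omega> i j l m)]
     else if s = {i, k, l} then vector [
        0,
        1 / (\<omega> i j k m * \<omega> i k l m),
        1 / (\<omega> i j k l * \<omega> i j k m)]
     else if s = {i, k, m} then vector [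
        0,
        - (1 / (\<omega> i j k m * \<omega> i k l m)),
        0]
     else if s = {i, l, m} then vector [
        1 / (\<omega> i j l m * \<omega> i k l m),
        (\<omega> i j k m - \<omega> i j k l) / (\<omega> i j k m * \<omega> i j l m * \<omega> i k l m),
        - (1 / (\<omega> i j k m * \<omega> i j l m))]
     else if s = {j, k, l} then vector [
        - (1 / (\<omega> i k l m * \<omega> j k l m)),
        - (1 / (\<omega> i j k m * \<omega> i k l m)),
        - (1 / (\<omega> i j k l * \<omega> i j k m))]
     else if s = {j, k, m} then vector [
        1 / (\<omega> i k l m * \<omega> j k l m),
        1 / (\<omega> i j k m * \<omega> i k l m),
        0]
     else if s = {j, l, m} then vector [
        - ((\<omega> j k l m + \<omega> i j l m) / (\<omega> i j l m * \<omega> i k l m * \<omega> j k l m)),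
        - ((\<omega> i j k m - \<omega> i j k l) / (\<omega> i j k m * \<omega> i j l m * \<omega> i k l m)),
        1 / (\<omega> i j k m * \<omega> i j l m)]
     else if s = {k, l, m} then vector [
        1 / (\<omega> i k l m * \<omega> j k l m),
        0,
        0]
     else 0)"

definition on_increasing ::
    "('v \<Rightarrow> 'v \<Rightarrow> 'v \<Rightarrow> 'v \<Rightarrow> 'v \<Rightarrow> 'b) \<Rightarrow> 'v::linorder set \<Rightarrow> 'b" where
  "on_increasing t u = (let p = sorted_list_of_set u in t (p ! 0) (p ! 1) (p ! 2) (p ! 3) (p ! 4))"

definition triangle_vector ::
    "'v::linorder set \<Rightarrow> ('v \<Rightarrow> 'v \<Rightarrow> 'v \<Rightarrow> 'v \<Rightarrow> 'a::field) \<Rightarrow> 'v set \<Rightarrow> 'v set \<Rightarrow> 'a ^ 3" where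
  "triangle_vector V \<omega> s = (\<lambda>u. if u \<in> simplices 4 V \<and> s \<subseteq> u
     then on_increasing (vector_table \<omega>) u s else 0)"

definition V_colorings ::
    "'v::linorder set \<Rightarrow> ('v \<Rightarrow> 'v \<Rightarrow> 'v \<Rightarrow> 'v \<Rightarrow> 'a::field) \<Rightarrow> ('v set \<Rightarrow> 'a ^ 3) set" where
  "V_colorings V \<omega> = coloring.span (triangle_vector V \<omega> ` simplices 2 V)"

text \<open>The boundary of \<open>v\<^sub>0 < \<dots> < v\<^sub>5\<close> is the sum over \<open>p\<close> of \<open>(-1) ^ p\<close> times the increasingly
  ordered face that omits \<open>v\<^sub>p\<close>, and \<open>p\<close> is the number of vertices below the omitted one.\<close>

definition orientation_sign :: "'v::linorder set \<Rightarrow> 'v set \<Rightarrow> 'a::field" where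
  "orientation_sign V u = (-1) ^ card {v \<in> V. v < the_elem (V - u)}"

definition triangle_functional ::
    "'v::linorder set \<Rightarrow> ('v \<Rightarrow> 'v \<Rightarrow> 'v \<Rightarrow> 'v \<Rightarrow> 'a::field) \<Rightarrow> 'v set \<Rightarrow> ('v set \<Rightarrow> 'a ^ 3) \<Rightarrow> 'a" where
  "triangle_functional V \<omega> s x = (\<Sum>u\<in>{u \<in> simplices 4 V. s \<subseteq> u}.
     orientation_sign V u * scalar_product (on_increasing (functional_table \<omega>) u s) (x u))"

definition F_colorings ::
    "'v::linorder set \<Rightarrow> ('v \<Rightarrow> 'v \<Rightarrow> 'v \<Rightarrow> 'v \<Rightarrow> 'a::field) \<Rightarrow> ('v set \<Rightarrow> 'a ^ 3) set" where
  "F_colorings V \<omega> = {x \<in> colorings V. \<forall>s\<in>simplices 2 V. triangle_functional V \<omega> s x = 0}"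

end

theory Submission
  imports Defs
begin

text \<open>
  On a 4-simplex \<open>u\<close>, the pairing of the rows \<open>f\<^sub>s\<close> and \<open>e\<^sub>t\<close> is the sum, over the tetrahedra \<open>\<tau>\<close>
  of \<open>u\<close> that contain both triangles, of \<open>[u : \<tau>] [\<tau> : s] [\<tau> : t] / \<omega>\<^sub>\<tau>\<close> with incidence numbers
  \<open>[\<sigma> : \<rho>] = \<plusminus>1\<close>. In the oriented sum over all \<open>u\<close> each tetrahedron occurs twice with opposite
  signs, hence V-colorings are F-colorings.

  Conversely, let the vertices be \<open>a < b < c < d < e < f\<close>. The triangle vectors of \<open>abe, abd, bde\<close> can
  be used to make an F-coloring zero on \<open>abcde\<close>, then those of \<open>abf, adf, bdf\<close> on \<open>abcdf\<close>, then
  those of \<open>aef, bef\<close> in two entries on \<open>abcef\<close> and that of \<open>def\<close> in one entry on \<open>abdef\<close>. An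
  F-coloring with these nine zeros is zero, because its remaining entries are killed one after the
  other by the triangle functionals.
\<close>

section \<open>Table rows and incidence numbers of one 4-simplex\<close>

lemma distinct_5:
  assumes "distinct [i, j, k, l, m]"
  shows "i \<noteq> j" "i \<noteq> k" "i \<noteq> l" "i \<noteq> m"
    "j \<noteq> i" "j \<noteq> k" "j \<noteq> l" "j \<noteq> m"
    "k \<noteq> i" "k \<noteq> j" "k \<noteq> l" "k \<noteq> m"
    "l \<noteq> i" "l \<noteq> j" "l \<noteq> k" "l \<noteq> m"
    "m \<noteq> i" "m \<noteq> j" "m \<noteq> k" "m \<noteq> l"
  using assms by auto

text \<open>The branches of the table compare sets of vertices, so distinctness of the five vertices
  is what makes all earlier branches fail.\<close>

lemma vector_table_face:
  assumes "distinct [i, j, k, l, m]"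
  shows "vector_table \<omega> i j k l m {i, j, k} = vector [0, \<omega> i k l m, \<omega> i j k m - \<omega> i j k l]"
    and "vector_table \<omega> i j k l m {i, j, l} = vector [0, 0, - \<omega> i j k m]"
    and "vector_table \<omega> i j k l m {i, j, m} = vector [0, - \<omega> i k l m, \<omega> i j k l]"
    and "vector_table \<omega> i j k l m {i, k, l} = vector [\<omega> j k l m, - \<omega> i j k m, \<omega> i j k m]"
    and "vector_table \<omega> i j k l m {i, k, m} =
      vector [- \<omega> j k l m, \<omega> i k l m + \<omega> i j k m, - \<omega> i j k l]"
    and "vector_table \<omega> i j k l m {i, l, m} = vector [\<omega> j k l m, - \<omega> i j k m, 0]"
    and "vector_table \<omega> i j k l m {j, k, l} = vector [- \<omega> i k l m, 0, - \<omega> i j k m]"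
    and "vector_table \<omega> i j k l m {j, k, m} = vector [\<omega> i k l m, - \<omega> i k l m, \<omega> i j k l]"
    and "vector_table \<omega> i j k l m {j, l, m} = vector [- \<omega> i k l m, 0, 0]"
    and "vector_table \<omega> i j k l m {k, l, m} = vector [\<omega> i k l m - \<omega> j k l m, \<omega> i j k m, 0]"
  by (simp_all add: vector_table_def set_eq_subset distinct_5[OF assms])

lemma functional_table_face:
  assumes "distinct [i, j, k, l, m]"
  shows "functional_table \<omega> i j k l m {i, j, k} = vector [0, 0, 1 / (\<omega> i j k l * \<omega> i j k m)]"
    and "functional_table \<omega> i j k l m {i, j, l} = vector [
        1 / (\<omega> i j l m * \<omega> i k l m),
        - ((\<omega> i k l m - \<omega> j k l m) / (\<omega> i j k m * \<omega> i j l m * \<omega> i k l m)),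
        - ((\<omega> i j l m + \<omega> i j k l) / (\<omega> i j k l * \<omega> i j k m * \<omega> i j l m))]"
    and "functional_table \<omega> i j k l m {i, j, m} = vector [
        - (1 / (\<omega> i j l m * \<omega> i k l m)),
        (\<omega> i k l m - \<omega> j k l m) / (\<omega> i j k m * \<omega> i j l m * \<omega> i k l m),
        1 / (\<omega> i j k m * \<omega> i j l m)]"
    and "functional_table \<omega> i j k l m {i, k, l} = vector [
        0, 1 / (\<omega> i j k m * \<omega> i k l m), 1 / (\<omega> i j k l * \<omega> i j k m)]"
    and "functional_table \<omega> i j k l m {i, k, m} = vector [
        0, - (1 / (\<omega> i j k m * \<omega> i k l m)), 0]"
    and "functional_table \<omega> i j k l m {i, l, m} = vector [
        1 / (\<omega> i j l m * \<omega> i k l m),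
        (\<omega> i j k m - \<omega> i j k l) / (\<omega> i j k m * \<omega> i j l m * \<omega> i k l m),
        - (1 / (\<omega> i j k m * \<omega> i j l m))]"
    and "functional_table \<omega> i j k l m {j, k, l} = vector [
        - (1 / (\<omega> i k l m * \<omega> j k l m)),
        - (1 / (\<omega> i j k m * \<omega> i k l m)),
        - (1 / (\<omega> i j k l * \<omega> i j k m))]"
    and "functional_table \<omega> i j k l m {j, k, m} = vector [
        1 / (\<omega> i k l m * \<omega> j k l m), 1 / (\<omega> i j k m * \<omega> i k l m), 0]"
    and "functional_table \<omega> i j k l m {j, l, m} = vector [
        - ((\<omega> j k l m + \<omega> i j l m) / (\<omega> i j l m * \<omega> i k l m * \<omega> j k l m)),
        - ((\<omega> i j k m - \<omega> i j k l) / (\<omega> i j k m * \<omega> i j l m * \<omega> i k l m)),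
        1 / (\<omega> i j k m * \<omega> i j l m)]"
    and "functional_table \<omega> i j k l m {k, l, m} = vector [1 / (\<omega> i k l m * \<omega> j k l m), 0, 0]"
  by (simp_all add: functional_table_def set_eq_subset distinct_5[OF assms])

definition triangles5 :: "'v \<Rightarrow> 'v \<Rightarrow> 'v \<Rightarrow> 'v \<Rightarrow> 'v \<Rightarrow> 'v set set" where
  "triangles5 i j k l m = {{i, j, k}, {i, j, l}, {i, j, m}, {i, k, l}, {i, k, m}, {i, l, m},
     {j, k, l}, {j, k, m}, {j, l, m}, {k, l, m}}"

lemma table_nonface:
  assumes "s \<notin> triangles5 i j k l m"
  shows "vector_table \<omega> i j k l m s = 0" "functional_table \<omega> i j k l m s = 0"
  using assms by (simp_all add: triangles5_def vector_table_def functional_table_def)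

text \<open>The incidence number of a tetrahedron and a triangle: \<open>(-1) ^ p\<close> if the
  triangle omits the vertex in position \<open>p\<close>, counted from 0. The default 0 lets sums
  run over all five tetrahedra of a 4-simplex.\<close>

definition face_sign :: "'v \<Rightarrow> 'v \<Rightarrow> 'v \<Rightarrow> 'v \<Rightarrow> 'v set \<Rightarrow> 'a::field" where
  "face_sign i j k l s = (if s = {j, k, l} then 1 else if s = {i, k, l} then - 1
     else if s = {i, j, l} then 1 else if s = {i, j, k} then - 1 else 0)"

definition face_product ::
    "('v \<Rightarrow> 'v \<Rightarrow> 'v \<Rightarrow> 'v \<Rightarrow> 'a::field) \<Rightarrow> 'v \<Rightarrow> 'v \<Rightarrow> 'v \<Rightarrow> 'v \<Rightarrow> 'v set \<Rightarrow> 'v set \<Rightarrow> 'a" where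
  "face_product \<omega> i j k l s t = face_sign i j k l s * face_sign i j k l t / \<omega> i j k l"

lemma face_sign_nonface:
  assumes "s \<notin> triangles5 i j k l m"
  shows "face_sign j k l m s = 0" "face_sign i k l m s = 0" "face_sign i j l m s = 0"
    "face_sign i j k m s = 0" "face_sign i j k l s = 0"
  using assms by (simp_all add: face_sign_def triangles5_def)

lemma face_sign_face:
  assumes "distinct [i, j, k, l, m]"
  shows "face_sign j k l m {i, j, k} = 0"
    and "face_sign j k l m {i, j, l} = 0"
    and "face_sign j k l m {i, j, m} = 0"
    and "face_sign j k l m {i, k, l} = 0"
    and "face_sign j k l m {i, k, m} = 0"
    and "face_sign j k l m {i, l, m} = 0"
    and "face_sign j k l m {j, k, l} = - 1"
    and "face_sign j k l m {j, k, m} = 1"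
    and "face_sign j k l m {j, l, m} = - 1"
    and "face_sign j k l m {k, l, m} = 1"
    and "face_sign i k l m {i, j, k} = 0"
    and "face_sign i k l m {i, j, l} = 0"
    and "face_sign i k l m {i, j, m} = 0"
    and "face_sign i k l m {i, k, l} = - 1"
    and "face_sign i k l m {i, k, m} = 1"
    and "face_sign i k l m {i, l, m} = - 1"
    and "face_sign i k l m {j, k, l} = 0"
    and "face_sign i k l m {j, k, m} = 0"
    and "face_sign i k l m {j, l, m} = 0"
    and "face_sign i k l m {k, l, m} = 1"
    and "face_sign i j l m {i, j, k} = 0"
    and "face_sign i j l m {i, j, l} = - 1"
    and "face_sign i j l m {i, j, m} = 1"
    and "face_sign i j l m {i, k, l} = 0"
    and "face_sign i j l m {i, k, m} = 0"
    and "face_sign i j l m {i, l, m} = - 1"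
    and "face_sign i j l m {j, k, l} = 0"
    and "face_sign i j l m {j, k, m} = 0"
    and "face_sign i j l m {j, l, m} = 1"
    and "face_sign i j l m {k, l, m} = 0"
    and "face_sign i j k m {i, j, k} = - 1"
    and "face_sign i j k m {i, j, l} = 0"
    and "face_sign i j k m {i, j, m} = 1"
    and "face_sign i j k m {i, k, l} = 0"
    and "face_sign i j k m {i, k, m} = - 1"
    and "face_sign i j k m {i, l, m} = 0"
    and "face_sign i j k m {j, k, l} = 0"
    and "face_sign i j k m {j, k, m} = 1"
    and "face_sign i j k m {j, l, m} = 0"
    and "face_sign i j k m {k, l, m} = 0"
    and "face_sign i j k l {i, j, k} = - 1"
    and "face_sign i j k l {i, j, l} = 1"
    and "face_sign i j k l {i, j, m} = 0"
    and "face_sign i j k l {i, k, l} = - 1"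
    and "face_sign i j k l {i, k, m} = 0"
    and "face_sign i j k l {i, l, m} = 0"
    and "face_sign i j k l {j, k, l} = 1"
    and "face_sign i j k l {j, k, m} = 0"
    and "face_sign i j k l {j, l, m} = 0"
    and "face_sign i j k l {k, l, m} = 0"
  by (simp_all add: face_sign_def set_eq_subset distinct_5[OF assms])

section \<open>Pairing of the two tables on one 4-simplex\<close>

lemma scalar_product_vector_3:
  "scalar_product (vector [x, y, z]) (v :: 'a::field ^ 3) = x * v $ 1 + y * v $ 2 + z * v $ 3"
  by (simp add: scalar_product_def sum_3)

text \<open>If \<open>s\<close> or \<open>t\<close> is not a face, both sides are 0. The remaining
  hundred pairs are rational identities in the five values of \<open>\<omega>\<close>, of which the
  cocycle relation eliminates one.\<close>

lemma scalar_product_tables: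
  assumes distinct: "distinct [i, j, k, l, m]"
    and cocycle: "\<omega> j k l m - \<omega> i k l m + \<omega> i j l m - \<omega> i j k m + \<omega> i j k l = 0"
    and nz: "\<omega> j k l m \<noteq> 0" "\<omega> i k l m \<noteq> 0" "\<omega> i j l m \<noteq> 0" "\<omega> i j k m \<noteq> 0" "\<omega> i j k l \<noteq> 0"
  shows "scalar_product (functional_table \<omega> i j k l m s) (vector_table \<omega> i j k l m t) =
    face_product \<omega> j k l m s t - face_product \<omega> i k l m s t + face_product \<omega> i j l m s t
    - face_product \<omega> i j k m s t + face_product \<omega> i j k l s t"
proof (cases "s \<in> triangles5 i j k l m \<and> t \<in> triangles5 i j k l m")
  case False
  then show ?thesis
    by (auto simp: face_product_def table_nonface face_sign_nonface scalar_product_def)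
next
  case True
  obtain A B C D E where eqs: "\<omega> i k l m = A" "\<omega> j k l m = B" "\<omega> i j k m = C"
      "\<omega> i j k l = D" "\<omega> i j l m = E"
    by blast
  have nonzero: "A \<noteq> 0" "B \<noteq> 0" "C \<noteq> 0" "D \<noteq> 0" "E \<noteq> 0" and E: "E = A - B + C - D"
    using nz cocycle by (simp_all add: eqs algebra_simps)
  note tables = functional_table_face [OF distinct] vector_table_face [OF distinct]
    face_sign_face [OF distinct]
  show ?thesis
    using True unfolding triangles5_def insert_iff empty_iff
    \<comment> \<open>Denominators are cleared while \<open>E\<close> is still an atom known to be
      nonzero; only then is it replaced by \<open>A - B + C - D\<close>.\<close>
    by (elim conjE disjE FalseE;
        simp only: tables scalar_product_vector_3 vector_3 face_product_def eqs;
        simp add: nonzero divide_simps; simp add: E algebra_simps)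
qed

text \<open>Allows the restriction to facets containing \<open>s\<close> to be dropped from
  functionals and vectors alike.\<close>

lemma table_not_subset:
  assumes "\<not> s \<subseteq> {i, j, k, l, m}"
  shows "vector_table \<omega> i j k l m s = 0" "functional_table \<omega> i j k l m s = 0"
  using assms by (auto intro!: table_nonface simp: triangles5_def)

section \<open>Increasing vertex order and facets\<close>

lemma on_increasing_insert:
  assumes "i < j" "j < k" "k < l" "l < m"
  shows "on_increasing t {i, j, k, l, m} = t i j k l m"
proof -
  have "sorted_list_of_set (set [i, j, k, l, m]) = [i, j, k, l, m]"
    using assms by (intro sorted_list_of_set.idem_if_sorted_distinct) auto
  then show ?thesis
    by (simp add: on_increasing_def)
qed

text \<open>Serves to index sums over 4-simplices by the omitted vertex, which also determines the
  orientation sign.\<close>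

lemma simplices_facets:
  assumes "card V = k + 2"
  shows "simplices k V = (\<lambda>v. V - {v}) ` V"
proof
  have fin: "finite V"
    using assms by (intro card_ge_0_finite) simp
  show "simplices k V \<subseteq> (\<lambda>v. V - {v}) ` V"
  proof
    fix u assume "u \<in> simplices k V"
    then have u: "u \<subseteq> V" "card u = k + 1"
      by (simp_all add: simplices_def)
    then have "card (V - u) = 1"
      using assms fin by (simp add: card_Diff_subset finite_subset)
    then obtain v where "V - u = {v}"
      by (auto simp: card_1_singleton_iff)
    with u show "u \<in> (\<lambda>v. V - {v}) ` V"
      by (intro image_eqI[of _ _ v]) auto
  qed
  show "(\<lambda>v. V - {v}) ` V \<subseteq> simplices k V"
    using assms fin by (auto simp: simplices_def)
qed

section \<open>Linear algebra of colorings\<close>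

lemma vec_3_eq_0I: "v = 0" if "v $ 1 = 0" "v $ 2 = 0" "v $ 3 = 0" for v :: "'a::zero ^ 3"
  using that by (simp add: vec_eq_iff forall_3)

lemma scalar_product_0 [simp]:
  "scalar_product 0 v = 0" "scalar_product v 0 = (0 :: 'a::semiring_1)"
  by (simp_all add: scalar_product_def)

text \<open>Gaussian elimination with a triangular matrix: a multiple of the first vector clears the
  first pivot entry, and the later vectors, being zero there, leave it cleared.\<close>

lemma triangular_elimination:
  fixes x :: "'v set \<Rightarrow> 'a::field ^ 3"
  assumes "sorted_wrt (\<lambda>(_, u, n) (e, _, _). e u $ n = 0) ps"
    and "\<forall>(e, u, n) \<in> set ps. e u $ n \<noteq> 0"
  shows "\<exists>v \<in> coloring.span (fst ` set ps). \<forall>(_, u, n) \<in> set ps. (x - v) u $ n = 0"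
  using assms
proof (induction ps arbitrary: x)
  case Nil
  then show ?case by (auto intro: coloring.span_zero)
next
  case (Cons p ps)
  obtain e u n where p: "p = (e, u, n)" by (cases p)
  define w where "w = coloring_scale (x u $ n / e u $ n) e"
  obtain v where v: "v \<in> coloring.span (fst ` set ps)"
    and z: "\<forall>(_, u, n) \<in> set ps. (x - w - v) u $ n = 0"
    using Cons.IH[of "x - w"] Cons.prems by auto
  \<comment> \<open>Vanishing at one entry is a linear condition, so it passes from the later
    vectors to the element \<open>v\<close> of their span.\<close>
  have "fst ` set ps \<subseteq> {g. g u $ n = 0}"
    using Cons.prems by (auto simp: p)
  moreover have "coloring.subspace {g :: 'v set \<Rightarrow> 'a ^ 3. g u $ n = 0}"
    by (simp add: coloring.subspace_def coloring_scale_def)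
  ultimately have "v u $ n = 0"
    using coloring.span_minimal v by blast
  moreover have "w u $ n = x u $ n"
    using Cons.prems by (simp add: w_def coloring_scale_def p)
  moreover have "w + v \<in> coloring.span (fst ` set (p # ps))"
  proof (rule coloring.span_add)
    show "w \<in> coloring.span (fst ` set (p # ps))"
      unfolding w_def by (rule coloring.span_scale) (simp add: coloring.span_base p)
    show "v \<in> coloring.span (fst ` set (p # ps))"
      using v coloring.span_mono[of "fst ` set ps" "fst ` set (p # ps)"] by auto
  qed
  moreover have "\<forall>(_, u, n) \<in> set ps. (x - (w + v)) u $ n = 0"
    using z by (auto simp: algebra_simps)
  ultimately show ?case
    by (intro bexI[of _ "w + v"]) (auto simp: p)
qed

text \<open>Used twice: to pass from the triangle vectors to their span, and to subtract a
  V-coloring from an F-coloring.\<close>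

lemma subspace_F_colorings: "coloring.subspace (F_colorings V \<omega>)"
  by (auto simp: coloring.subspace_def F_colorings_def colorings_def coloring_scale_def
      triangle_functional_def scalar_product_def algebra_simps sum.distrib simp flip: sum_distrib_left)

section \<open>Functionals as signed sums over facets; conditions on the cochains\<close>

lemma orientation_sign_facet:
  "v \<in> V \<Longrightarrow> orientation_sign V (V - {v}) = (- 1) ^ card {w \<in> V. w < v}"
  by (simp add: orientation_sign_def double_diff)

lemma triangle_functional_facets:
  assumes "card V = 6"
  shows "triangle_functional V \<omega> s x = (\<Sum>v\<in>V. if s \<subseteq> V - {v} then (- 1) ^ card {w \<in> V. w < v}
    * scalar_product (on_increasing (functional_table \<omega>) (V - {v}) s) (x (V - {v})) else 0)"
proof -
  have "finite V"
    using assms by (intro card_ge_0_finite) simp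
  moreover have "inj_on (\<lambda>v. V - {v}) V"
    by (auto simp: inj_on_def)
  ultimately show ?thesis
    using assms unfolding triangle_functional_def
    by (subst simplices_facets)
      (simp_all add: sum.inter_filter sum.reindex orientation_sign_facet cong: if_cong)
qed

lemma generic_nonzero:
  assumes "generic V \<omega>" "distinct [i, j, k, l]" "{i, j, k, l} \<subseteq> V"
  shows "\<omega> i j k l \<noteq> 0"
  using assms by (simp add: generic_def)

lemma cocycle3_relation:
  assumes "cocycle3 V \<omega>" "distinct [i, j, k, l, m]" "{i, j, k, l, m} \<subseteq> V"
  shows "\<omega> j k l m - \<omega> i k l m + \<omega> i j l m - \<omega> i j k m + \<omega> i j k l = 0"
  using assms by (simp add: cocycle3_def)

lemma is_coboundary_of_eq:
  assumes "is_coboundary_of V \<omega> \<gamma>" "distinct [i, j, k, l]" "{i, j, k, l} \<subseteq> V"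
  shows "coboundary2 \<gamma> i j k l = \<omega> i j k l"
  using assms by (simp add: is_coboundary_of_def)

text \<open>The table evaluates its cochain only at the five increasing tetrahedra, which are tuples
  of distinct vertices of \<open>V\<close>; there \<open>coboundary2 \<gamma>\<close> and
  \<open>\<omega>\<close> agree.\<close>

lemma functional_table_coboundary:
  assumes "is_coboundary_of V \<omega> \<gamma>" "distinct [i, j, k, l, m]" "{i, j, k, l, m} \<subseteq> V"
  shows "functional_table (coboundary2 \<gamma>) i j k l m = functional_table \<omega> i j k l m"
proof -
  have "coboundary2 \<gamma> j k l m = \<omega> j k l m" "coboundary2 \<gamma> i k l m = \<omega> i k l m"
    "coboundary2 \<gamma> i j l m = \<omega> i j l m" "coboundary2 \<gamma> i j k m = \<omega> i j k m"
    "coboundary2 \<gamma> i j k l = \<omega> i j k l"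
    using assms(2,3) by (auto intro!: is_coboundary_of_eq [OF assms(1)])
  then show ?thesis
    unfolding functional_table_def by (simp only:)
qed

section \<open>Coordinates for six increasing vertices\<close>

locale increasing_6 =
  fixes a b c d e f :: "'v::linorder"
  assumes less: "a < b" "b < c" "c < d" "d < e" "e < f"
begin

abbreviation "V \<equiv> {a, b, c, d, e, f}"

lemma increasing [simp]: "a < b" "a < c" "a < d" "a < e" "a < f"
    "b < c" "b < d" "b < e" "b < f" "c < d"
    "c < e" "c < f" "d < e" "d < f" "e < f"
  using less by auto

lemmas not_less [simp] = increasing [THEN less_not_sym]
lemmas neq [simp] = increasing [THEN less_imp_neq] increasing [THEN less_imp_neq, THEN not_sym]

lemma facet:
  shows "{a, b, c, d, e, f} - {a} = {b, c, d, e, f}"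
    and "{a, b, c, d, e, f} - {b} = {a, c, d, e, f}"
    and "{a, b, c, d, e, f} - {c} = {a, b, d, e, f}"
    and "{a, b, c, d, e, f} - {d} = {a, b, c, e, f}"
    and "{a, b, c, d, e, f} - {e} = {a, b, c, d, f}"
    and "{a, b, c, d, e, f} - {f} = {a, b, c, d, e}"
  by (auto dest: sym)

lemma card_V: "card V = 6"
  by simp

lemma simplices_4: "simplices 4 V =
    {{b, c, d, e, f},
     {a, c, d, e, f},
     {a, b, d, e, f},
     {a, b, c, e, f},
     {a, b, c, d, f},
     {a, b, c, d, e}}"
  by (subst simplices_facets) (simp_all add: facet)

lemma triangle_functional_eq:
  "triangle_functional V \<omega> s x =
     scalar_product (functional_table \<omega> b c d e f s) (x {b, c, d, e, f})
     - scalar_product (functional_table \<omega> a c d e f s) (x {a, c, d, e, f})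
     + scalar_product (functional_table \<omega> a b d e f s) (x {a, b, d, e, f})
     - scalar_product (functional_table \<omega> a b c e f s) (x {a, b, c, e, f})
     + scalar_product (functional_table \<omega> a b c d f s) (x {a, b, c, d, f})
     - scalar_product (functional_table \<omega> a b c d e s) (x {a, b, c, d, e})"
proof -
  let ?g = "\<lambda>v. scalar_product (on_increasing (functional_table \<omega>) (V - {v}) s) (x (V - {v}))"
  have nonface: "?g v = 0" if "v \<in> V" "\<not> s \<subseteq> V - {v}" for v
    using that by (elim insertE emptyE)
      (simp_all only: facet, simp_all add: on_increasing_insert table_not_subset scalar_product_def)
  \<comment> \<open>As a sum over six explicit vertices, the exponent of the sign is computed by
    simplification.\<close>
  have card: "card {w \<in> V. w < v} = (\<Sum>w\<in>V. if w < v then 1 else 0)" for v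
    unfolding card_eq_sum by (rule sum.inter_filter) simp
  have "(if s \<subseteq> V - {v} then z * ?g v else 0) = z * ?g v" if "v \<in> V" for v z
    by (cases "s \<subseteq> V - {v}")
      (simp_all only: if_True if_False not_False_eq_True nonface [OF that] mult_zero_right)
  then have "triangle_functional V \<omega> s x = (\<Sum>v\<in>V. (- 1) ^ card {w \<in> V. w < v} * ?g v)"
    unfolding triangle_functional_facets [OF card_V] by (rule sum.cong [OF refl])
  then show ?thesis
    unfolding card by (simp add: facet on_increasing_insert)
qed

lemma triangle_vector_facet:
  shows "triangle_vector {a, b, c, d, e, f} \<omega> s {b, c, d, e, f} = vector_table \<omega> b c d e f s"
    and "triangle_vector {a, b, c, d, e, f} \<omega> s {a, c, d, e, f} = vector_table \<omega> a c d e f s"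
    and "triangle_vector {a, b, c, d, e, f} \<omega> s {a, b, d, e, f} = vector_table \<omega> a b d e f s"
    and "triangle_vector {a, b, c, d, e, f} \<omega> s {a, b, c, e, f} = vector_table \<omega> a b c e f s"
    and "triangle_vector {a, b, c, d, e, f} \<omega> s {a, b, c, d, f} = vector_table \<omega> a b c d f s"
    and "triangle_vector {a, b, c, d, e, f} \<omega> s {a, b, c, d, e} = vector_table \<omega> a b c d e s"
  by (auto simp: triangle_vector_def simplices_4 on_increasing_insert table_not_subset)

end

section \<open>The two inclusions\<close>

locale generic_cocycle_6 = increasing_6 +
  fixes \<omega> :: "'a::linorder \<Rightarrow> 'a \<Rightarrow> 'a \<Rightarrow> 'a \<Rightarrow> 'b::field"
  assumes cocycle: "cocycle3 V \<omega>" and generic: "generic V \<omega>"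
begin

lemmas nonzero = generic_nonzero [OF generic]

lemma scalar_product_facet:
  assumes "distinct [i, j, k, l, m]" "{i, j, k, l, m} \<subseteq> V"
  shows "scalar_product (functional_table \<omega> i j k l m s) (vector_table \<omega> i j k l m t) =
    face_product \<omega> j k l m s t - face_product \<omega> i k l m s t + face_product \<omega> i j l m s t
    - face_product \<omega> i j k m s t + face_product \<omega> i j k l s t"
proof (rule scalar_product_tables)
  show "\<omega> j k l m - \<omega> i k l m + \<omega> i j l m - \<omega> i j k m + \<omega> i j k l = 0"
    using cocycle3_relation [OF cocycle assms] .
qed (use assms in \<open>auto simp: nonzero\<close>)

text \<open>Six facets with five tetrahedra each give thirty \<open>face_product\<close> terms, two
  with opposite signs for each of the fifteen tetrahedra.\<close>

lemma triangle_functional_triangle_vector: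
  "triangle_functional V \<omega> s (triangle_vector V \<omega> t) = 0"
  by (simp add: triangle_functional_eq triangle_vector_facet scalar_product_facet)

lemma V_subset_F: "V_colorings V \<omega> \<subseteq> F_colorings V \<omega>"
  unfolding V_colorings_def
proof (rule coloring.span_minimal[OF _ subspace_F_colorings])
  show "triangle_vector V \<omega> ` simplices 2 V \<subseteq> F_colorings V \<omega>"
    \<comment> \<open>The functionals are evaluated with \<open>triangle_vector\<close> folded; it
      is unfolded only for the zeros off the 4-simplices.\<close>
    by (auto simp: F_colorings_def triangle_functional_triangle_vector)
      (auto simp: colorings_def triangle_vector_def)
qed

text \<open>Each triangle lies in three facets. The triangles are taken in an order such that two of
  these already have color zero and the row on the third leaves a single unknown entry, with nonzero
  coefficient.\<close>

lemma F_coloring_eq_0: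
  assumes F: "y \<in> F_colorings V \<omega>"
    and z: "y {a, b, c, d, e} $ 2 = 0"
      "y {a, b, c, d, e} $ 3 = 0"
      "y {a, b, c, d, e} $ 1 = 0"
      "y {a, b, c, d, f} $ 3 = 0"
      "y {a, b, c, d, f} $ 2 = 0"
      "y {a, b, c, d, f} $ 1 = 0"
      "y {a, b, c, e, f} $ 2 = 0"
      "y {a, b, c, e, f} $ 1 = 0"
      "y {a, b, d, e, f} $ 2 = 0"
  shows "y = 0"
proof -
  note tables [simp] = functional_table_face table_not_subset scalar_product_vector_3 nonzero
  have functional: "triangle_functional V \<omega> s y = 0" if "s \<subseteq> V" "card s = 3" for s
    using F that by (simp add: F_colorings_def simplices_def)
  have u5 [simp]: "y {a, b, c, d, e} = 0"
    using z by (intro vec_3_eq_0I)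
  have u4 [simp]: "y {a, b, c, d, f} = 0"
    using z by (intro vec_3_eq_0I)
  \<comment> \<open>\<open>{a, b, c}\<close> has row 123 on this facet, where only the third entry
    is nonzero.\<close>
  have c3_3 [simp]: "y {a, b, c, e, f} $ 3 = 0"
    using functional [of "{a, b, c}"] z by (simp add: triangle_functional_eq)
  have u3 [simp]: "y {a, b, c, e, f} = 0"
    using z c3_3 by (intro vec_3_eq_0I)
  have c2_3 [simp]: "y {a, b, d, e, f} $ 3 = 0"
    using functional [of "{a, b, d}"] z by (simp add: triangle_functional_eq)
  \<comment> \<open>Row 124 involves all three entries, but the second and third colors are already
    zero.\<close>
  have c2_1 [simp]: "y {a, b, d, e, f} $ 1 = 0"
    using functional [of "{a, b, e}"] z by (simp add: triangle_functional_eq)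
  have u2 [simp]: "y {a, b, d, e, f} = 0"
    using z c2_3 c2_1 by (intro vec_3_eq_0I)
  have c1_3 [simp]: "y {a, c, d, e, f} $ 3 = 0"
    using functional [of "{a, c, d}"] z by (simp add: triangle_functional_eq)
  \<comment> \<open>Row 135, with only the second entry nonzero.\<close>
  have c1_2 [simp]: "y {a, c, d, e, f} $ 2 = 0"
    using functional [of "{a, d, f}"] z by (simp add: triangle_functional_eq)
  have c1_1 [simp]: "y {a, c, d, e, f} $ 1 = 0"
    using functional [of "{a, c, e}"] z by (simp add: triangle_functional_eq)
  have u1 [simp]: "y {a, c, d, e, f} = 0"
    using z c1_3 c1_2 c1_1 by (intro vec_3_eq_0I)
  \<comment> \<open>The same three rows as for the previous facet, with \<open>b\<close> in place of
    \<open>a\<close>.\<close>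
  have c0_3 [simp]: "y {b, c, d, e, f} $ 3 = 0"
    using functional [of "{b, c, d}"] z by (simp add: triangle_functional_eq)
  have c0_2 [simp]: "y {b, c, d, e, f} $ 2 = 0"
    using functional [of "{b, d, f}"] z by (simp add: triangle_functional_eq)
  have c0_1 [simp]: "y {b, c, d, e, f} $ 1 = 0"
    using functional [of "{b, c, e}"] z by (simp add: triangle_functional_eq)
  have u0 [simp]: "y {b, c, d, e, f} = 0"
    using z c0_3 c0_2 c0_1 by (intro vec_3_eq_0I)
  have "y u = 0" for u
    using F by (cases "u \<in> simplices 4 V") (auto simp: F_colorings_def colorings_def simplices_4)
  then show ?thesis
    by (simp add: fun_eq_iff)
qed

lemma F_subset_V: "F_colorings V \<omega> \<subseteq> V_colorings V \<omega>"
proof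
  fix x assume x: "x \<in> F_colorings V \<omega>"
  \<comment> \<open>Nine pivots: a triangle vector and an entry of it that is plus or minus a single value of \<open>\<omega>\<close>;
    all later vectors of the list vanish at that entry.\<close>
  let ?ps = "[(triangle_vector V \<omega> {a, b, e}, {a, b, c, d, e}, 2),
      (triangle_vector V \<omega> {a, b, d}, {a, b, c, d, e}, 3),
      (triangle_vector V \<omega> {b, d, e}, {a, b, c, d, e}, 1),
      (triangle_vector V \<omega> {a, b, f}, {a, b, c, d, f}, 3),
      (triangle_vector V \<omega> {a, d, f}, {a, b, c, d, f}, 2),
      (triangle_vector V \<omega> {b, d, f}, {a, b, c, d, f}, 1),
      (triangle_vector V \<omega> {a, e, f}, {a, b, c, e, f}, 2),
      (triangle_vector V \<omega> {b, e, f}, {a, b, c, e, f}, 1),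
      (triangle_vector V \<omega> {d, e, f}, {a, b, d, e, f}, 2)] :: (('a set \<Rightarrow> 'b ^ 3) \<times> 'a set \<times> 3) list"
  \<comment> \<open>Vectors of later groups vanish on the facets of earlier groups: from the fourth
    on, the triangles contain \<open>f\<close>; the last three also contain \<open>e\<close>; the
    last one also contains \<open>d\<close>. Within a group, the table rows are triangular.\<close>
  have "sorted_wrt (\<lambda>(_, u, n) (e, _, _). e u $ n = 0) ?ps"
    by (simp add: triangle_vector_facet vector_table_face table_not_subset vector_3)
  moreover have "\<forall>(e, u, n) \<in> set ?ps. e u $ n \<noteq> 0"
    by (simp add: triangle_vector_facet vector_table_face nonzero vector_3)
  ultimately obtain v where v: "v \<in> coloring.span (fst ` set ?ps)"
    and z: "\<forall>(_, u, n) \<in> set ?ps. (x - v) u $ n = 0"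
    using triangular_elimination by blast
  have "coloring.span (fst ` set ?ps) \<subseteq> V_colorings V \<omega>"
    unfolding V_colorings_def by (intro coloring.span_mono) (simp add: simplices_def)
  with v have v: "v \<in> V_colorings V \<omega>" by blast
  \<comment> \<open>The inclusion already proved makes \<open>v\<close> an F-coloring, so the
    difference is one too, now with the nine zeros of \<open>F_coloring_eq_0\<close>.\<close>
  have "x - v \<in> F_colorings V \<omega>"
    using subspace_F_colorings x v V_subset_F by (blast intro: coloring.subspace_diff)
  then have "x - v = 0"
    by (rule F_coloring_eq_0) (use z in simp_all)
  then show "x \<in> V_colorings V \<omega>"
    using v by simp
qed

end

section \<open>Ordering the vertices and passing from \<open>\<gamma>\<close> to
  \<open>\<omega>\<close>\<close>

lemma increasing_6_exists:
  fixes V :: "'v::linorder set"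
  assumes "card V = 6"
  obtains a b c d e f where "increasing_6 a b c d e f" "V = {a, b, c, d, e, f}"
proof -
  have fin: "finite V" using assms by (intro card_ge_0_finite) simp
  define p where "p = sorted_list_of_set V"
  have "length p = 6" using assms by (simp add: p_def)
  then obtain a b c d e f where p: "p = [a, b, c, d, e, f]"
    by (auto simp: numeral_eq_Suc length_Suc_conv)
  have "sorted_wrt (<) p" using strict_sorted_list_of_set by (simp add: p_def)
  moreover have "V = set p" using fin by (simp add: p_def)
  ultimately show thesis
    by (intro that[of a b c d e f]) (auto simp: p increasing_6_def)
qed

theorem theorem9:
  fixes V :: "'v::linorder set"
    and \<omega> :: "'v \<Rightarrow> 'v \<Rightarrow> 'v \<Rightarrow> 'v \<Rightarrow> 'a::field"
    and \<gamma> :: "'v \<Rightarrow> 'v \<Rightarrow> 'v \<Rightarrow> 'a"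
  assumes "card V = 6"
    and "cocycle3 V \<omega>"
    and "generic V \<omega>"
    and "cochain2 V \<gamma>"
    and "is_coboundary_of V \<omega> \<gamma>"
  shows "F_colorings V (coboundary2 \<gamma>) = V_colorings V \<omega>"
proof -
  obtain a b c d e f where inc: "increasing_6 a b c d e f" and V: "V = {a, b, c, d, e, f}"
    using increasing_6_exists assms(1) by blast
  interpret generic_cocycle_6 a b c d e f \<omega>
    using inc assms(2,3) by (simp add: generic_cocycle_6_def generic_cocycle_6_axioms_def V)
  have "triangle_functional V (coboundary2 \<gamma>) = triangle_functional V \<omega>"
    unfolding V triangle_functional_eq fun_eq_iff
    by (simp add: functional_table_coboundary [OF assms(5)[unfolded V]])
  then have "F_colorings V (coboundary2 \<gamma>) = F_colorings V \<omega>"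
    by (simp add: F_colorings_def)
  then show ?thesis
    using V_subset_F F_subset_V by (simp add: V)
qed

end
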